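(* For any nonempty open subset $O$ of $\ell^2$, one has $C_{\mathcal G}^\infty(O)\nsubseteq B_{\ell^2}(O)$; that is, there is a function in $C_{\mathcal G}^\infty(O)$ which is not Borel measurable.
   Context: $\ell^2=\ell^2(\mathbb N)$ is the real Hilbert space of square-summable sequences with its norm topology and standard orthonormal basis $\{\mathbf e_k\}_{k\ge1}$. For a nonempty open $O\subset\ell^2$, $B_{\ell^2}(O)$ is the set of all real-valued Borel measurable functions on $O$. A function $h:O\to\mathbb R$ is $\mathcal G$-continuous if for every $\mathbf x\in O$ and every nonzero finite-dimensional linear subspace $L$ of $\ell^2$, the function $\mathbf y\mapsto h(\mathbf x+\mathbf y)$ is continuous on $\{\mathbf y\in L:\mathbf x+\mathbf y\in O\}$; $C_{\mathcal G}(O)$ is the set of all such functions. The partial derivatives are $\frac{\partial h}{\partial x_j}(\mathbf x)=\lim_{\tau\to0}\frac{h(\mathbf x+\tau\mathbf e_j)-h(\mathbf x)}{\tau}$, and higher order partial derivatives are defined inductively. For $k\in\mathbb N$, $C^k_{\mathcal G}(O)$ is the set of functions in $C_{\mathcal G}(O)$ all of whose partial derivatives up to order $k$ exist and belong to $C_{\mathcal G}(O)$, and $C_{\mathcal G}^\infty(O)=\bigcap_{k\ge1}C_{\mathcal G}^k(O)$. *)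

theory Defs
  imports "HOL-Analysis.Analysis"
begin

typedef ell2 = "{x :: nat \<Rightarrow> real. summable (\<lambda>n. (x n)\<^sup>2)}"
  morphisms coord Abs_ell2
  by (rule exI[of _ "\<lambda>_. 0"]) simp

setup_lifting type_definition_ell2

lemma summable_sq_prod:
  fixes x y :: "nat \<Rightarrow> real"
  assumes "summable (\<lambda>n. (x n)\<^sup>2)" "summable (\<lambda>n. (y n)\<^sup>2)"
  shows "summable (\<lambda>n. x n * y n)"
proof (rule summable_comparison_test')
  show "summable (\<lambda>n. (x n)\<^sup>2 + (y n)\<^sup>2)"
    using assms by (rule summable_add)
  fix n :: nat
  have "2 * (\<bar>x n\<bar> * \<bar>y n\<bar>) \<le> (x n)\<^sup>2 + (y n)\<^sup>2"
    using sum_squares_bound[of "\<bar>x n\<bar>" "\<bar>y n\<bar>"] by simp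
  moreover have "0 \<le> \<bar>x n\<bar> * \<bar>y n\<bar>"
    by simp
  ultimately show "norm (x n * y n) \<le> (x n)\<^sup>2 + (y n)\<^sup>2"
    unfolding real_norm_def abs_mult by linarith
qed

lemma summable_sq_add:
  fixes x y :: "nat \<Rightarrow> real"
  assumes "summable (\<lambda>n. (x n)\<^sup>2)" "summable (\<lambda>n. (y n)\<^sup>2)"
  shows "summable (\<lambda>n. (x n + y n)\<^sup>2)"
proof -
  have "summable (\<lambda>n. (x n)\<^sup>2 + (y n)\<^sup>2 + 2 * (x n * y n))"
    by (intro summable_add summable_mult assms summable_sq_prod)
  then show ?thesis
    by (simp add: power2_sum mult.assoc)
qed

instantiation ell2 :: real_vector
begin

lift_definition zero_ell2 :: ell2 is "\<lambda>_. 0"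
  by simp

lift_definition uminus_ell2 :: "ell2 \<Rightarrow> ell2" is "\<lambda>x n. - x n"
  by simp

lift_definition plus_ell2 :: "ell2 \<Rightarrow> ell2 \<Rightarrow> ell2" is "\<lambda>x y n. x n + y n"
  by (rule summable_sq_add)

lift_definition minus_ell2 :: "ell2 \<Rightarrow> ell2 \<Rightarrow> ell2" is "\<lambda>x y n. x n - y n"
  using summable_sq_add[where y = "\<lambda>n. - y n" for y] by simp

lift_definition scaleR_ell2 :: "real \<Rightarrow> ell2 \<Rightarrow> ell2" is "\<lambda>c x n. c * x n"
  by (simp add: power_mult_distrib summable_mult)

instance
  by standard (transfer; simp add: algebra_simps)+

end

instantiation ell2 :: real_inner
begin

lift_definition inner_ell2 :: "ell2 \<Rightarrow> ell2 \<Rightarrow> real" is "\<lambda>x y. \<Sum>n. x n * y n" .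

definition norm_ell2 :: "ell2 \<Rightarrow> real" where
  "norm_ell2 x = sqrt (inner x x)"

definition sgn_ell2 :: "ell2 \<Rightarrow> ell2" where
  "sgn_ell2 x = x /\<^sub>R norm x"

definition dist_ell2 :: "ell2 \<Rightarrow> ell2 \<Rightarrow> real" where
  "dist_ell2 x y = norm (x - y)"

definition uniformity_ell2 :: "(ell2 \<times> ell2) filter" where
  "uniformity_ell2 = (INF e\<in>{0<..}. principal {(x, y). dist x y < e})"

definition open_ell2 :: "ell2 set \<Rightarrow> bool" where
  "open_ell2 U \<longleftrightarrow> (\<forall>x\<in>U. eventually (\<lambda>(x', y). x' = x \<longrightarrow> y \<in> U) uniformity)"

instance
proof
  fix x y z :: ell2 and r :: real
  show "inner x y = inner y x"
    by transfer (simp add: mult.commute)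
  show "inner (x + y) z = inner x z + inner y z"
    by transfer (simp add: distrib_right suminf_add summable_sq_prod)
  show "inner (scaleR r x) y = r * inner x y"
    by transfer (simp add: mult.assoc suminf_mult summable_sq_prod)
  show "0 \<le> inner x x"
    by transfer (simp add: suminf_nonneg flip: power2_eq_square)
  show "inner x x = 0 \<longleftrightarrow> x = 0"
  proof transfer
    fix x :: "nat \<Rightarrow> real"
    assume "summable (\<lambda>n. (x n)\<^sup>2)"
    then have "(\<Sum>n. (x n)\<^sup>2) = 0 \<longleftrightarrow> (\<forall>n. (x n)\<^sup>2 = 0)"
      by (rule suminf_eq_zero_iff) simp
    then show "(\<Sum>n. x n * x n) = 0 \<longleftrightarrow> x = (\<lambda>_. 0)"
      by (auto simp: power2_eq_square)
  qed
qed (rule norm_ell2_def sgn_ell2_def dist_ell2_def uniformity_ell2_def open_ell2_def)+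

end

text \<open>The orthonormal basis is indexed from 0, so \<open>ell2_basis k\<close> is the usual
  basis vector of index \<open>k + 1\<close>.\<close>

lift_definition ell2_basis :: "nat \<Rightarrow> ell2" is "\<lambda>k n. if n = k then 1 else 0"
  by (rule summable_finite[of "{k}" for k]) auto

text \<open>Real-valued functions on \<open>U\<close> are represented by total functions on \<^typ>\<open>ell2\<close> whose
  values outside \<open>U\<close> are irrelevant; every notion below depends only on the restriction to the
  open set \<open>U\<close>.\<close>

definition borel_fun :: "ell2 set \<Rightarrow> (ell2 \<Rightarrow> real) set" where
  "borel_fun U = borel_measurable (restrict_space borel U)"

definition CG :: "ell2 set \<Rightarrow> (ell2 \<Rightarrow> real) set" where
  "CG U = {h. \<forall>x\<in>U. \<forall>L. subspace L \<and> (\<exists>B. finite B \<and> span B = L) \<and> L \<noteq> {0} \<longrightarrow>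
    continuous_on {y \<in> L. x + y \<in> U} (\<lambda>y. h (x + y))}"

definition has_partial_deriv :: "(ell2 \<Rightarrow> real) \<Rightarrow> nat \<Rightarrow> ell2 \<Rightarrow> real \<Rightarrow> bool" where
  "has_partial_deriv h j x D \<longleftrightarrow>
    ((\<lambda>t. (h (x + t *\<^sub>R ell2_basis j) - h x) / t) \<longlongrightarrow> D) (at 0)"

text \<open>Where the limit does not exist, the value of \<open>partial_deriv\<close> is unspecified; existence is
  required separately below.\<close>

definition partial_deriv :: "nat \<Rightarrow> (ell2 \<Rightarrow> real) \<Rightarrow> ell2 \<Rightarrow> real" where
  "partial_deriv j h x = Lim (at 0) (\<lambda>t. (h (x + t *\<^sub>R ell2_basis j) - h x) / t)"

text \<open>\<open>iter_partial_deriv [j1, ..., jm] h\<close> differentiates \<open>h\<close> first in direction \<open>jm\<close> and last in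
  direction \<open>j1\<close>.\<close>

fun iter_partial_deriv :: "nat list \<Rightarrow> (ell2 \<Rightarrow> real) \<Rightarrow> ell2 \<Rightarrow> real" where
  "iter_partial_deriv [] h = h"
| "iter_partial_deriv (j # js) h = partial_deriv j (iter_partial_deriv js h)"

text \<open>The partial derivatives of order \<open>1, ..., k\<close> are those given by the lists \<open>j # js\<close>
  with \<open>length js < k\<close>.\<close>

definition CG_k :: "nat \<Rightarrow> ell2 set \<Rightarrow> (ell2 \<Rightarrow> real) set" where
  "CG_k k U = {h \<in> CG U. \<forall>j js. length js < k \<longrightarrow>
    (\<forall>x\<in>U. \<exists>D. has_partial_deriv (iter_partial_deriv js h) j x D) \<and>
    iter_partial_deriv (j # js) h \<in> CG U}"

definition CG_inf :: "ell2 set \<Rightarrow> (ell2 \<Rightarrow> real) set" where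
  "CG_inf U = (\<Inter>k\<in>{1..}. CG_k k U)"

end

theory Submission
  imports Defs
begin

text \<open>Every linear functional on \<open>ell2\<close>, continuous or not, lies in \<^term>\<open>CG_inf U\<close>: it is
  continuous on finite-dimensional subspaces, its first partial derivatives are constant, and the
  higher ones vanish. It therefore suffices to find a linear functional that is not Borel measurable
  on \<open>U\<close>.

  For this, take a continuous curve of unit vectors whose values at distinct parameters are linearly
  independent (lemmas \<open>continuous_on_coherent\<close> and \<open>independent_coherent\<close>). Independence allows the
  values of a linear functional along the curve to be prescribed arbitrarily, and the choice made is
  the indicator function of a non-measurable set \<open>N\<close> of reals. As the curve is
  bounded, a translated and rescaled copy of it stays inside \<open>U\<close>. Along that copy the functional is
  an affine function of the indicator of \<open>N\<close>, so Borel measurability on \<open>U\<close> would make \<open>N\<close> a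
  Borel set.\<close>

section \<open>A non-measurable set of reals\<close>

text \<open>Vitali's argument. A set \<open>N\<close> of representatives of \<open>\<real> / \<rat>\<close>, chosen in \<open>{0..1}\<close>, has
  rational translates that are pairwise disjoint and cover the line. If \<open>N\<close> were null, the line
  would be null as well. If it had positive measure, then finitely many of the translates by
  \<open>1 / (k + 1)\<close>, all contained in \<open>{0..2}\<close>, would have total measure greater than 2.\<close>

lemma Vitali_not_lebesgue_measurable: "\<exists>N :: real set. N \<notin> sets lebesgue"
proof -
  define r :: "real \<Rightarrow> real" where "r x = (SOME y. y \<in> {0..1} \<and> x - y \<in> \<rat>)" for x
  have r: "r x \<in> {0..1} \<and> x - r x \<in> \<rat>" for x
  proof -
    have "frac x \<in> {0..1} \<and> x - frac x \<in> \<rat>"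
      by (simp add: frac_def less_imp_le[OF frac_lt_1, unfolded frac_def])
    then show ?thesis
      unfolding r_def by (rule someI)
  qed
  have r_cong: "r x = r y" if "x - y \<in> \<rat>" for x y
  proof -
    have "x - z \<in> \<rat> \<longleftrightarrow> y - z \<in> \<rat>" for z
      using Rats_diff[of "x - z" "x - y"] Rats_add[of "y - z" "x - y"] that by auto
    then show ?thesis
      by (simp add: r_def)
  qed
  define N where "N = range r"
  have N01: "N \<subseteq> {0..1}"
    using r by (auto simp: N_def)
  have N_eq: "x = y" if "x \<in> N" "y \<in> N" "x - y \<in> \<rat>" for x y
  proof -
    obtain u v where uv: "x = r u" "y = r v"
      using \<open>x \<in> N\<close> \<open>y \<in> N\<close> by (auto simp: N_def)
    have "r u = x" "r v = y"
      by (simp_all add: uv)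
    moreover have "r u = r x" "r v = r y"
      unfolding uv by (rule r_cong, use r in blast)+
    moreover have "r x = r y"
      using \<open>x - y \<in> \<rat>\<close> by (rule r_cong)
    ultimately show ?thesis
      by metis
  qed
  have "N \<notin> sets lebesgue"
  proof
    assume "N \<in> sets lebesgue"
    then have N: "N \<in> lmeasurable"
      by (intro bounded_set_imp_lmeasurable bounded_subset[OF bounded_closed_interval N01])
    define m where "m = measure lebesgue N"
    have "\<not> negligible N"
    proof
      assume "negligible N"
      then have "negligible (\<Union>q\<in>\<rat>. (+) q ` N)"
        by (auto intro!: negligible_countable_Union negligible_translation countable_rat)
      moreover have "x \<in> (\<Union>q\<in>\<rat>. (+) q ` N)" for x
        using r[of x] by (intro UN_I[of "x - r x"] image_eqI[of _ _ "r x"]) (auto simp: N_def)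
      ultimately have "negligible (UNIV :: real set)"
        by (metis UNIV_eq_I)
      then show False
        by simp
    qed
    then have "m > 0"
      using N negligible_iff_measure[of N] measure_nonneg[of lebesgue N]
      by (auto simp: m_def less_le)
    then obtain n :: nat where n: "real n * m > 2"
      using reals_Archimedean3 by blast
    define T where "T k = (+) (1 / real (Suc k)) ` N" for k :: nat
    have T: "T k \<in> lmeasurable" "measure lebesgue (T k) = m" for k
      using N measurable_translation measure_translation unfolding T_def m_def by blast+
    have disj: "disjoint_family_on T {..<n}"
      unfolding disjoint_family_on_def
    proof (intro ballI impI)
      fix i j :: nat
      assume "i \<noteq> j"
      {
        fix x y
        assume xy: "x \<in> N" "y \<in> N" "1 / real (Suc i) + x = 1 / real (Suc j) + y"
        then have "x - y = 1 / real (Suc j) - 1 / real (Suc i)"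
          by simp
        then have "x - y \<in> \<rat>"
          by (metis Rats_1 Rats_diff Rats_divide Rats_of_nat)
        then have "x = y"
          using N_eq xy by blast
        with xy(3) \<open>i \<noteq> j\<close> have False
          by (simp add: field_simps)
      }
      then show "T i \<inter> T j = {}"
        unfolding T_def by fast
    qed
    have fin: "emeasure lebesgue (T k) \<noteq> \<infinity>" for k
      using fmeasurableD2[OF T(1)] by simp
    have "real n * m = measure lebesgue (\<Union>k<n. T k)"
      using measure_finite_Union[OF finite_lessThan _ disj fin] T by (auto simp: image_subset_iff)
    also have "\<dots> \<le> measure lebesgue {0..2::real}"
    proof (rule measure_mono_fmeasurable)
      have "1 / real (Suc k) + x \<in> {0..2}" if "x \<in> N" for x k
      proof -
        have "1 / real (Suc k) \<le> 1"
          by simp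
        then show ?thesis
          using add_mono[of "1 / real (Suc k)" 1 x 1] subsetD[OF N01 that] by simp
      qed
      then show "(\<Union>k<n. T k) \<subseteq> {0..2}"
        unfolding T_def by blast
      show "(\<Union>k<n. T k) \<in> sets lebesgue"
        using T by (intro sets.finite_UN) (auto intro: fmeasurableD)
    qed simp
    also have "\<dots> = 2"
      by simp
    finally show False
      using n by simp
  qed
  then show ?thesis ..
qed

section \<open>Linear functionals are smooth along finite-dimensional subspaces\<close>

text \<open>With an orthogonal generating set \<open>C\<close> of the span, the coefficients of a vector \<open>y\<close> are inner
  products with \<open>y\<close>. On the span, \<open>f\<close> is therefore a finite sum of continuous scalar functions
  times fixed vectors \<open>f c\<close>.\<close>

lemma linear_continuous_on_finite_span:
  fixes f :: "'a::real_inner \<Rightarrow> 'b::real_normed_vector"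
  assumes "linear f" and "finite B"
  shows "continuous_on (span B) f"
proof -
  obtain C where C: "finite C" "span C = span B" "pairwise orthogonal C"
    using basis_orthogonal[OF \<open>finite B\<close>] by blast
  define P where "P y = (\<Sum>c\<in>C. (y \<bullet> c / (c \<bullet> c)) *\<^sub>R f c)" for y
  have "linear P"
    unfolding P_def
    by (intro linear_compose_sum ballI linearI)
      (auto simp: inner_add_left add_divide_distrib scaleR_add_left)
  \<comment> \<open>\<open>C\<close> may contain \<open>0\<close>; its summand is harmless because \<open>f 0 = 0\<close>.\<close>
  have fP: "f b = P b" if "b \<in> C" for b
  proof -
    have "P b = (\<Sum>c\<in>C. if c = b then f b else 0)"
      unfolding P_def
    proof (rule sum.cong)
      fix c assume "c \<in> C"
      then have "b \<bullet> c = 0" if "c \<noteq> b"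
        using C(3) \<open>b \<in> C\<close> that by (auto simp: pairwise_def orthogonal_def)
      then show "(b \<bullet> c / (c \<bullet> c)) *\<^sub>R f c = (if c = b then f b else 0)"
        using linear_0[OF \<open>linear f\<close>] by (cases "b = 0") auto
    qed simp
    then show ?thesis
      using C(1) that by simp
  qed
  have "f y = P y" if "y \<in> span B" for y
    using linear_eq_on[OF \<open>linear f\<close> \<open>linear P\<close> _ fP] that C(2) by blast
  moreover have "continuous_on (span B) P"
    unfolding P_def divide_inverse by (intro continuous_intros)
  ultimately show ?thesis
    by (simp cong: continuous_on_cong)
qed

lemma linear_in_CG:
  assumes "linear f"
  shows "f \<in> CG U"
  unfolding CG_def
proof (clarify)
  fix x and B :: "ell2 set"
  assume "finite B"
  then have "continuous_on {y \<in> span B. x + y \<in> U} f"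
    by (intro continuous_on_subset[OF linear_continuous_on_finite_span[OF assms]]) auto
  then show "continuous_on {y \<in> span B. x + y \<in> U} (\<lambda>y. f (x + y))"
    unfolding linear_add[OF assms] by (intro continuous_intros)
qed

lemma has_partial_deriv_imp_eq:
  assumes "has_partial_deriv h j x D"
  shows "partial_deriv j h x = D"
  using assms unfolding has_partial_deriv_def partial_deriv_def by (intro tendsto_Lim) auto

lemma has_partial_deriv_linear:
  assumes "linear f"
  shows "has_partial_deriv f j x (f (ell2_basis j))"
proof -
  have "\<forall>\<^sub>F t in at 0. f (ell2_basis j) = (f (x + t *\<^sub>R ell2_basis j) - f x) / t"
    by (simp add: linear_add[OF assms] linear_scale[OF assms] eventually_at_filter)
  then show ?thesis
    unfolding has_partial_deriv_def by (rule Lim_transform_eventually[OF tendsto_const])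
qed

lemma has_partial_deriv_const: "has_partial_deriv (\<lambda>_. c) j x 0"
  by (simp add: has_partial_deriv_def)

lemma iter_partial_deriv_linear:
  assumes "linear f"
  shows "\<exists>c. iter_partial_deriv (j # js) f = (\<lambda>_. c)"
proof (induction js arbitrary: j)
  case Nil
  then show ?case
    using has_partial_deriv_imp_eq[OF has_partial_deriv_linear[OF assms]] by (auto simp: fun_eq_iff)
next
  case (Cons k js)
  then obtain c where "iter_partial_deriv (k # js) f = (\<lambda>_. c)"
    by blast
  then show ?case
    using has_partial_deriv_imp_eq[OF has_partial_deriv_const, of j c]
    unfolding iter_partial_deriv.simps(2)[of j] by auto
qed

lemma linear_in_CG_inf:
  assumes "linear f"
  shows "f \<in> CG_inf U"
proof -
  have "\<exists>D. has_partial_deriv (iter_partial_deriv js f) j x D" for j js x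
  proof (cases js)
    case Nil
    then show ?thesis
      using has_partial_deriv_linear[OF assms] by auto
  next
    case (Cons k ks)
    then obtain c where "iter_partial_deriv js f = (\<lambda>_. c)"
      using iter_partial_deriv_linear[OF assms] by blast
    then show ?thesis
      using has_partial_deriv_const by auto
  qed
  moreover have "iter_partial_deriv (j # js) f \<in> CG U" for j js
  proof -
    obtain c where "iter_partial_deriv (j # js) f = (\<lambda>_. c)"
      using iter_partial_deriv_linear[OF assms] by blast
    then show ?thesis
      by (simp add: CG_def)
  qed
  ultimately show ?thesis
    using linear_in_CG[OF assms] by (auto simp: CG_inf_def CG_k_def)
qed

section \<open>A continuous curve of linearly independent unit vectors\<close>

text \<open>The curve below consists of the real coherent states, which realise the Gaussian kernel as an
  inner product. This is the exponential series of \<open>s * t\<close> with the Gaussian factors pulled in.\<close>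

lemma coherent_sums:
  fixes s t :: real
  shows "(\<lambda>n. (exp (- s\<^sup>2 / 2) * s ^ n / sqrt (fact n)) * (exp (- t\<^sup>2 / 2) * t ^ n / sqrt (fact n)))
    sums exp (- (s - t)\<^sup>2 / 2)"
proof -
  have "(\<lambda>n. (s * t) ^ n /\<^sub>R fact n) sums exp (s * t)"
    by (rule exp_converges)
  then have "(\<lambda>n. exp (- s\<^sup>2 / 2) * exp (- t\<^sup>2 / 2) * ((s * t) ^ n /\<^sub>R fact n))
      sums (exp (- s\<^sup>2 / 2) * exp (- t\<^sup>2 / 2) * exp (s * t))"
    by (rule sums_mult)
  moreover have "exp (- s\<^sup>2 / 2) * exp (- t\<^sup>2 / 2) * exp (s * t) = exp (- (s - t)\<^sup>2 / 2)"
  proof -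
    have "- (s - t)\<^sup>2 / 2 = - s\<^sup>2 / 2 + - t\<^sup>2 / 2 + s * t"
      by (simp add: power2_diff)
    then show ?thesis
      by (simp only: exp_add)
  qed
  moreover have "a * b * ((s * t) ^ n /\<^sub>R fact n) = (a * s ^ n / sqrt (fact n)) * (b * t ^ n / sqrt (fact n))"
    for a b :: real and n
    by (simp add: power_mult_distrib divide_simps)
  ultimately show ?thesis
    by (simp only:)
qed

lift_definition coherent :: "real \<Rightarrow> ell2" is "\<lambda>t n. exp (- t\<^sup>2 / 2) * t ^ n / sqrt (fact n)"
  using coherent_sums[of t t for t] by (auto simp: sums_iff power2_eq_square)

lemma inner_coherent: "coherent s \<bullet> coherent t = exp (- (s - t)\<^sup>2 / 2)"
  by transfer (rule sums_unique[OF coherent_sums, symmetric])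

lemma norm_coherent: "norm (coherent t) = 1"
  by (simp add: norm_eq_sqrt_inner inner_coherent)

text \<open>The closed form of the inner product gives
  \<open>2 - 2 * exp (- (s - t)\<^sup>2 / 2)\<close> for the squared distance of two points of the curve.\<close>

lemma continuous_on_coherent: "continuous_on UNIV coherent"
proof -
  have "(coherent \<longlongrightarrow> coherent t) (at t)" for t
  proof -
    have "norm (coherent s - coherent t) = sqrt (2 - 2 * exp (- (s - t)\<^sup>2 / 2))" for s
      by (simp add: norm_eq_sqrt_inner inner_diff_left inner_diff_right inner_coherent
          power2_commute[of t s])
    moreover have "((\<lambda>s. sqrt (2 - 2 * exp (- (s - t)\<^sup>2 / 2))) \<longlongrightarrow> sqrt (2 - 2 * exp (- (t - t)\<^sup>2 / 2))) (at t)"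
      by (intro tendsto_intros) simp
    ultimately show ?thesis
      by (subst LIM_zero_iff[symmetric], subst tendsto_norm_zero_iff[symmetric]) simp
  qed
  then show ?thesis
    by (simp add: continuous_on_def)
qed

lemma coord_sum: "coord (sum f A) n = (\<Sum>a\<in>A. coord (f a) n)"
  by (induction A rule: infinite_finite_induct) (simp_all add: zero_ell2.rep_eq plus_ell2.rep_eq)

lemma inj_coherent: "inj coherent"
proof (rule injI)
  fix s t assume "coherent s = coherent t"
  then have "coherent s \<bullet> coherent t = 1"
    by (simp add: inner_coherent)
  then show "s = t"
    by (simp add: inner_coherent)
qed

text \<open>Up to nonzero factors depending only on \<open>t\<close> or only on \<open>n\<close>, the coordinates are the powers
  \<open>t ^ n\<close>. A vanishing finite combination therefore annihilates every polynomial evaluated at the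
  nodes, and a polynomial vanishing at all nodes but one isolates the coefficient of that node.\<close>

lemma independent_coherent: "independent (range coherent)"
  unfolding independent_explicit_finite_subsets
proof (intro allI impI ballI)
  fix S u v
  assume S: "S \<subseteq> range coherent" "finite S" "(\<Sum>v\<in>S. u v *\<^sub>R v) = 0" and v: "v \<in> S"
  obtain T where T: "S = coherent ` T" "finite T"
    using S(1,2) finite_subset_image[of S coherent UNIV] by auto
  define w where "w t = u (coherent t) * exp (- t\<^sup>2 / 2)" for t
  have comb: "(\<Sum>t\<in>T. u (coherent t) *\<^sub>R coherent t) = 0"
    using S(3) unfolding T(1) by (subst (asm) sum.reindex) (auto intro: inj_on_subset[OF inj_coherent])
  have pow: "(\<Sum>t\<in>T. w t * t ^ n) = 0" for n
  proof -
    have "0 = (\<Sum>t\<in>T. u (coherent t) * (exp (- t\<^sup>2 / 2) * t ^ n / sqrt (fact n)))"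
      using arg_cong[OF comb, of "\<lambda>x. coord x n"]
      by (simp add: coord_sum scaleR_ell2.rep_eq coherent.rep_eq zero_ell2.rep_eq)
    also have "\<dots> = (\<Sum>t\<in>T. w t * t ^ n) / sqrt (fact n)"
      by (simp add: sum_divide_distrib w_def mult_ac)
    finally show ?thesis
      by simp
  qed
  have poly0: "(\<Sum>t\<in>T. w t * poly p t) = 0" for p
  proof -
    have "(\<Sum>t\<in>T. w t * poly p t) = (\<Sum>i\<le>degree p. coeff p i * (\<Sum>t\<in>T. w t * t ^ i))"
      by (simp add: poly_altdef sum_distrib_left mult_ac) (rule sum.swap)
    then show ?thesis
      by (simp add: pow)
  qed
  obtain t where t: "t \<in> T" "v = coherent t"
    using v T(1) by blast
  define p where "p = (\<Prod>s\<in>T - {t}. [:- s, 1:])"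
  have "poly p s = 0" if "s \<in> T - {t}" for s
    using that T(2) by (auto simp: p_def poly_prod prod_zero_iff)
  then have "(\<Sum>s\<in>T. w s * poly p s) = w t * poly p t"
    using T(2) t(1) by (subst sum.remove[of _ t]) auto
  moreover have "poly p t \<noteq> 0"
    using T(2) by (auto simp: p_def poly_prod prod_zero_iff)
  ultimately have "w t = 0"
    using poly0[of p] by simp
  then show "u v = 0"
    by (simp add: w_def t(2))
qed

section \<open>A non-measurable linear functional\<close>

theorem corollary2p1:
  fixes U :: "ell2 set"
  assumes "open U" and "U \<noteq> {}"
  shows "\<not> CG_inf U \<subseteq> borel_fun U"
proof -
  obtain N :: "real set" where N: "N \<notin> sets borel"
    using Vitali_not_lebesgue_measurable by (metis sets_completionI_sets sets_lborel)
  obtain f :: "ell2 \<Rightarrow> real" where f: "linear f"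
    and f_ind: "\<And>x. x \<in> range coherent \<Longrightarrow> f x = indicator N (inv coherent x)"
    using linear_independent_extend[OF independent_coherent, of "\<lambda>x. indicator N (inv coherent x)"]
    by blast
  have f_coherent: "f (coherent t) = indicator N t" for t
    using f_ind[of "coherent t"] inj_coherent by simp
  obtain x e where x: "x \<in> U" and e: "e > 0" "cball x e \<subseteq> U"
    using assms open_contains_cball by blast
  define g where "g t = x + e *\<^sub>R coherent t" for t
  have "g t \<in> U" for t
    using e by (auto simp: g_def dist_norm norm_coherent intro!: subsetD[OF e(2)])
  moreover have "g \<in> borel_measurable borel"
    unfolding g_def
    by (intro borel_measurable_continuous_onI continuous_intros continuous_on_coherent)
  ultimately have g: "g \<in> borel \<rightarrow>\<^sub>M restrict_space borel U"
    by (intro measurable_restrict_space2) auto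
  have "f \<notin> borel_fun U"
  proof
    assume "f \<in> borel_fun U"
    then have "(\<lambda>t. f (g t)) \<in> borel_measurable borel"
      unfolding borel_fun_def using g by (rule measurable_compose[rotated])
    then have "(\<lambda>t. (f (g t) - f x) / e) \<in> borel_measurable borel"
      by measurable
    moreover have "(f (g t) - f x) / e = indicator N t" for t
      using e(1) by (simp add: g_def linear_add[OF f] linear_scale[OF f] f_coherent)
    ultimately have "(indicator N :: real \<Rightarrow> real) \<in> borel_measurable borel"
      by simp
    then show False
      using N by (simp add: borel_measurable_indicator_iff)
  qed
  then show ?thesis
    using linear_in_CG_inf[OF f] by blast
qed

end
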